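(* Let $a,b,c$ be integers and $r,s,t$ real numbers, let $(V_n)_{n\ge 0}$ be the associated generalized Tribonacci sequence, and let $\varphi_n$ be the $n$th generalized Tribonacci hyperbolic spinor. Then, as formal power series in $x$, $$\sum_{n=0}^\infty \varphi_n x^n=\frac{\varphi_0+(\varphi_1-r\varphi_0)x+(\varphi_2-r\varphi_1-s\varphi_0)x^2}{1-rx-sx^2-tx^3},$$ where $$\varphi_0=\begin{bmatrix} a+(rc+sb+ta)j\\ -b+cj\end{bmatrix},\quad \varphi_1-r\varphi_0=\begin{bmatrix} b-ar+(sc+tb)j\\ -c+rb+(sb+ta)j\end{bmatrix},\quad \varphi_2-r\varphi_1-s\varphi_0=\begin{bmatrix} c-rb-sa+tc\,j\\ -ta+tb\,j\end{bmatrix}.$$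
   Context: Hyperbolic numbers are the elements $x+yj$ with $x,y\in\mathbb{R}$ and $j^2=1$ (a commutative ring). A hyperbolic spinor is a column vector with two hyperbolic number components; addition and scalar multiplication are componentwise. Given integers $a,b,c$ and real numbers $r,s,t$, the generalized Tribonacci sequence $(V_n)_{n\ge0}$ is defined by $V_0=a$, $V_1=b$, $V_2=c$ and $V_n=rV_{n-1}+sV_{n-2}+tV_{n-3}$ for $n\ge 3$. The $n$th generalized Tribonacci hyperbolic spinor is $\varphi_n=\begin{bmatrix} V_n+V_{n+3}j\\ -V_{n+1}+V_{n+2}j\end{bmatrix}$, $n\ge 0$. Power series with spinor coefficients are understood componentwise. *)

theory Defs
  imports "HOL-Analysis.Analysis" "HOL-Computational_Algebra.Formal_Power_Series"
begin

text \<open>\<open>Hyp x y\<close> is the hyperbolic number \<open>x + y j\<close>.\<close>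

datatype hyperbolic = Hyp (hyp_re: real) (hyp_im: real)

lemma hyperbolic_eq_iff: "z = w \<longleftrightarrow> hyp_re z = hyp_re w \<and> hyp_im z = hyp_im w"
  by (cases z; cases w) simp

instantiation hyperbolic :: "{comm_ring_1, real_algebra_1, inverse}"
begin

definition "0 = Hyp 0 0"
definition "1 = Hyp 1 0"
definition "z + w = Hyp (hyp_re z + hyp_re w) (hyp_im z + hyp_im w)"
definition "- z = Hyp (- hyp_re z) (- hyp_im z)"
definition "z - w = Hyp (hyp_re z - hyp_re w) (hyp_im z - hyp_im w)"
definition "z * w =
  Hyp (hyp_re z * hyp_re w + hyp_im z * hyp_im w) (hyp_re z * hyp_im w + hyp_im z * hyp_re w)"
definition "scaleR r z = Hyp (r * hyp_re z) (r * hyp_im z)"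

text \<open>
  The multiplicative inverse of a unit, and \<open>0\<close> for the zero divisors \<open>x \<plusminus> x j\<close>. The type class
  \<open>inverse\<close> carries no axioms; it is what \<^const>\<open>inverse\<close> on formal power series is built on, where
  only the inverse of the constant coefficient is used.
\<close>

definition "inverse z =
  Hyp (hyp_re z / ((hyp_re z)\<^sup>2 - (hyp_im z)\<^sup>2)) (- hyp_im z / ((hyp_re z)\<^sup>2 - (hyp_im z)\<^sup>2))"
definition "z div w = z * inverse (w :: hyperbolic)"

instance
  by standard
    (simp_all add: hyperbolic_eq_iff zero_hyperbolic_def one_hyperbolic_def plus_hyperbolic_def
      uminus_hyperbolic_def minus_hyperbolic_def times_hyperbolic_def scaleR_hyperbolic_def
      algebra_simps)

end

definition hyp_j :: hyperbolic
  where "hyp_j = Hyp 0 1"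

lemma hyp_j_square: "hyp_j * hyp_j = 1"
  by (simp add: hyp_j_def times_hyperbolic_def one_hyperbolic_def)

lemma Hyp_eq: "Hyp x y = of_real x + of_real y * hyp_j"
  by (simp add: hyp_j_def of_real_def plus_hyperbolic_def times_hyperbolic_def
      one_hyperbolic_def scaleR_hyperbolic_def)

lemma hyperbolic_right_inverse:
  assumes "z * w = (1::hyperbolic)"
  shows "z * inverse z = 1"
proof -
  let ?N = "\<lambda>u. (hyp_re u)\<^sup>2 - (hyp_im u)\<^sup>2"
  have "?N z * ?N w = ?N (z * w)"
    by (simp add: times_hyperbolic_def power2_eq_square algebra_simps)
  also have "\<dots> = 1"
    by (simp add: assms one_hyperbolic_def)
  finally have "?N z \<noteq> 0" by auto
  then show ?thesis
    by (simp add: inverse_hyperbolic_def times_hyperbolic_def one_hyperbolic_def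
        power2_eq_square diff_divide_distrib[symmetric])
qed

type_synonym hyperbolic_spinor = "hyperbolic ^ 2"

fun gen_tribonacci :: "int \<Rightarrow> int \<Rightarrow> int \<Rightarrow> real \<Rightarrow> real \<Rightarrow> real \<Rightarrow> nat \<Rightarrow> real"
  where
    "gen_tribonacci a b c r s t 0 = of_int a"
  | "gen_tribonacci a b c r s t (Suc 0) = of_int b"
  | "gen_tribonacci a b c r s t (Suc (Suc 0)) = of_int c"
  | "gen_tribonacci a b c r s t (Suc (Suc (Suc n))) =
       r * gen_tribonacci a b c r s t (Suc (Suc n)) + s * gen_tribonacci a b c r s t (Suc n)
       + t * gen_tribonacci a b c r s t n"

definition tribonacci_spinor ::
    "int \<Rightarrow> int \<Rightarrow> int \<Rightarrow> real \<Rightarrow> real \<Rightarrow> real \<Rightarrow> nat \<Rightarrow> hyperbolic_spinor"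
  where "tribonacci_spinor a b c r s t n =
    (let V = gen_tribonacci a b c r s t
     in vector [of_real (V n) + of_real (V (n + 3)) * hyp_j,
                - of_real (V (n + 1)) + of_real (V (n + 2)) * hyp_j])"

text \<open>
  Power series with spinor coefficients are understood componentwise, that is, as column vectors of
  two power series over the hyperbolic numbers. In this module over the ring of hyperbolic power
  series, the fraction with numerator \<open>N\<close> and scalar denominator \<open>D\<close> is \<open>inverse D *s N\<close>.
\<close>

definition spinor_fps :: "(nat \<Rightarrow> hyperbolic_spinor) \<Rightarrow> hyperbolic fps ^ 2"
  where "spinor_fps \<phi> = (\<chi> i. Abs_fps (\<lambda>n. \<phi> n $ i))"

definition spinor_const :: "hyperbolic_spinor \<Rightarrow> hyperbolic fps ^ 2"
  where "spinor_const u = (\<chi> i. fps_const (u $ i))"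

lemma tribonacci_denom_inverse:
  fixes r s t :: real
  defines "D \<equiv> 1 - fps_const (of_real r :: hyperbolic) * fps_X - fps_const (of_real s) * fps_X ^ 2
    - fps_const (of_real t) * fps_X ^ 3"
  shows "D * inverse D = 1"
proof -
  have "fps_nth D 0 = 1"
    by (simp add: D_def)
  moreover have "(1::hyperbolic) * inverse 1 = 1"
    by (rule hyperbolic_right_inverse) simp
  ultimately show ?thesis
    unfolding fps_inverse_def by (intro fps_right_inverse) simp
qed

end

theory Submission
  imports Defs
begin

text \<open>
  Multiplying the generating series of a third-order linear recurrence by the reversed characteristic
  polynomial \<open>D = 1 - r x - s x\<^sup>2 - t x\<^sup>3\<close> makes the coefficient of \<open>x\<^bsup>n+3\<^esup>\<close> equal to
  \<open>u\<^bsub>n+3\<^esub> - r u\<^bsub>n+2\<^esub> - s u\<^bsub>n+1\<^esub> - t u\<^bsub>n\<^esub> = 0\<close>, so only the three initial coefficients remain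
  (\<open>recurrence_fps_mult_denom\<close>). This uses no division and is valid over any commutative ring. The
  spinors \<open>\<phi>\<^sub>n\<close> inherit the recurrence of \<open>V\<^sub>n\<close>, because each of their entries is a linear
  combination of shifts of \<open>V\<close> (\<open>tribonacci_spinor_recurrence\<close>); hence the identity applies to both
  components.

  The hyperbolic numbers have zero divisors, so one cannot cancel \<open>D\<close> by appealing to a field.
  It is a unit nevertheless, since its constant coefficient is \<open>1\<close>, and multiplying by its
  inverse turns the identity into the quotient formula. The explicit numerators follow from the
  recurrence for \<open>V\<^sub>3\<close>, \<open>V\<^sub>4\<close> and \<open>V\<^sub>5\<close>.
\<close>

lemma recurrence_fps_mult_denom:
  fixes u :: "nat \<Rightarrow> 'a::comm_ring_1"
  assumes rec: "\<And>n. u (n + 3) = r * u (n + 2) + s * u (n + 1) + t * u n"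
  shows "(1 - fps_const r * fps_X - fps_const s * fps_X ^ 2 - fps_const t * fps_X ^ 3) * Abs_fps u
    = fps_const (u 0) + fps_X * fps_const (u 1 - r * u 0)
      + fps_X ^ 2 * fps_const (u 2 - r * u 1 - s * u 0)"
    (is "?D * ?U = ?N")
proof (rule fps_ext)
  fix n
  have "?D * ?U = ?U - fps_const r * (fps_X * ?U) - fps_const s * (fps_X ^ 2 * ?U)
      - fps_const t * (fps_X ^ 3 * ?U)"
    by (simp add: algebra_simps)
  then have D: "fps_nth (?D * ?U) n = u n - r * (if n = 0 then 0 else u (n - 1))
      - s * (if n < 2 then 0 else u (n - 2)) - t * (if n < 3 then 0 else u (n - 3))"
    by (simp add: fps_X_power_mult_nth)
  have N: "fps_nth ?N n = (if n = 0 then u 0 else 0) + (if n = 1 then u 1 - r * u 0 else 0)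
      + (if n = 2 then u 2 - r * u 1 - s * u 0 else 0)"
    by (auto simp: fps_X_power_mult_nth)
  consider "n = 0" | "n = 1" | "n = 2" | m where "n = m + 3"
  proof -
    have "n = 0 \<or> n = 1 \<or> n = 2 \<or> n = (n - 3) + 3"
      by arith
    then show thesis
      using that by blast
  qed
  then show "fps_nth (?D * ?U) n = fps_nth ?N n"
  proof cases
    case 4
    have "m + 3 - 1 = m + 2" "m + 3 - 2 = m + 1"
      by simp_all
    then show ?thesis
      unfolding D N using rec[of m] 4 by simp
  qed (unfold D N, simp_all)
qed

lemma tribonacci_spinor_recurrence:
  "tribonacci_spinor a b c r s t (n + 3) $ i
    = of_real r * tribonacci_spinor a b c r s t (n + 2) $ i
      + of_real s * tribonacci_spinor a b c r s t (n + 1) $ i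
      + of_real t * tribonacci_spinor a b c r s t n $ i"
proof -
  have V: "gen_tribonacci a b c r s t (k + 3) = r * gen_tribonacci a b c r s t (k + 2)
      + s * gen_tribonacci a b c r s t (k + 1) + t * gen_tribonacci a b c r s t k" for k
    by (simp add: numeral_2_eq_2 numeral_3_eq_3)
  (* The entries of the spinor with index n + 3 are V(n + 3), ..., V(n + 6). *)
  show ?thesis
    using exhaust_2[of i] V[of n] V[of "n + 1"] V[of "n + 2"] V[of "n + 3"]
    by (auto simp: tribonacci_spinor_def Let_def algebra_simps)
qed

theorem theorem3p8:
  fixes a b c :: int and r s t :: real
    and \<phi> :: "nat \<Rightarrow> hyperbolic_spinor"
  defines "\<phi> \<equiv> tribonacci_spinor a b c r s t"
  shows "(spinor_fps \<phi> =
      inverse (1 - fps_const (of_real r) * fps_X - fps_const (of_real s) * fps_X ^ 2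
                 - fps_const (of_real t) * fps_X ^ 3)
        *s (spinor_const (\<phi> 0)
            + fps_X *s spinor_const (\<phi> 1 - r *\<^sub>R \<phi> 0)
            + fps_X ^ 2 *s spinor_const (\<phi> 2 - r *\<^sub>R \<phi> 1 - s *\<^sub>R \<phi> 0)))
    \<and> \<phi> 0 = vector [of_real a + of_real (r * c + s * b + t * a) * hyp_j,
                       - of_real b + of_real c * hyp_j]
    \<and> \<phi> 1 - r *\<^sub>R \<phi> 0 =
         vector [of_real (b - a * r) + of_real (s * c + t * b) * hyp_j,
                 of_real (- c + r * b) + of_real (s * b + t * a) * hyp_j]
    \<and> \<phi> 2 - r *\<^sub>R \<phi> 1 - s *\<^sub>R \<phi> 0 =
         vector [of_real (c - r * b - s * a) + of_real (t * c) * hyp_j,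
                 of_real (- t * a) + of_real (t * b) * hyp_j]"
proof (intro conjI)
  have eq_by_components: "u = v" if "u $ 1 = v $ 1" "u $ 2 = v $ 2" for u v :: hyperbolic_spinor
    using that by (simp add: vec_eq_iff forall_2)
  let ?D = "1 - fps_const (of_real r :: hyperbolic) * fps_X - fps_const (of_real s) * fps_X ^ 2
    - fps_const (of_real t) * fps_X ^ 3"
  let ?N = "spinor_const (\<phi> 0) + fps_X *s spinor_const (\<phi> 1 - r *\<^sub>R \<phi> 0)
    + fps_X ^ 2 *s spinor_const (\<phi> 2 - r *\<^sub>R \<phi> 1 - s *\<^sub>R \<phi> 0)"
  have "spinor_fps \<phi> $ i = inverse ?D * ?N $ i" for i
  proof -
    have rec: "\<phi> (n + 3) $ i = of_real r * \<phi> (n + 2) $ i + of_real s * \<phi> (n + 1) $ i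
        + of_real t * \<phi> n $ i" for n
      unfolding \<phi>_def by (rule tribonacci_spinor_recurrence)
    (* Real scaling must become a product only in the entries: the spinors themselves form a
       real algebra too, so the unrestricted rule would rewrite the vectors before their entries. *)
    have N: "?N $ i = fps_const (\<phi> 0 $ i) + fps_X * fps_const (\<phi> 1 $ i - of_real r * \<phi> 0 $ i)
        + fps_X ^ 2 * fps_const (\<phi> 2 $ i - of_real r * \<phi> 1 $ i - of_real s * \<phi> 0 $ i)"
      by (simp add: spinor_const_def scaleR_conv_of_real[where 'a = hyperbolic])
    have "?D * spinor_fps \<phi> $ i = ?N $ i"
      unfolding N spinor_fps_def vec_lambda_beta by (rule recurrence_fps_mult_denom) (rule rec)
    then have "inverse ?D * ?N $ i = inverse ?D * (?D * spinor_fps \<phi> $ i)"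
      by (simp only:)
    also have "\<dots> = (?D * inverse ?D) * spinor_fps \<phi> $ i"
      by (simp only: mult.assoc mult.commute mult.left_commute)
    finally show ?thesis
      by (simp only: tribonacci_denom_inverse mult_1_left)
  qed
  then show "spinor_fps \<phi> = inverse ?D *s ?N"
    unfolding vec_eq_iff vector_smult_component by blast

  let ?V = "gen_tribonacci a b c r s t"
  have V: "?V 2 = c" "?V 3 = r * ?V 2 + s * ?V 1 + t * ?V 0" "?V 4 = r * ?V 3 + s * ?V 2 + t * ?V 1"
      "?V 5 = r * ?V 4 + s * ?V 3 + t * ?V 2"
    by (simp_all add: eval_nat_numeral)
  note entries = \<phi>_def tribonacci_spinor_def V scaleR_conv_of_real[where 'a = hyperbolic]
  show "\<phi> 0 = vector [of_real a + of_real (r * c + s * b + t * a) * hyp_j,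
      - of_real b + of_real c * hyp_j]"
    by (rule eq_by_components) (simp_all add: entries algebra_simps)
  show "\<phi> 1 - r *\<^sub>R \<phi> 0 =
      vector [of_real (b - a * r) + of_real (s * c + t * b) * hyp_j,
              of_real (- c + r * b) + of_real (s * b + t * a) * hyp_j]"
    by (rule eq_by_components) (simp_all add: entries algebra_simps)
  show "\<phi> 2 - r *\<^sub>R \<phi> 1 - s *\<^sub>R \<phi> 0 =
      vector [of_real (c - r * b - s * a) + of_real (t * c) * hyp_j,
              of_real (- t * a) + of_real (t * b) * hyp_j]"
    by (rule eq_by_components) (simp_all add: entries algebra_simps)
qed

end
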